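(* Let $\mathcal{G}_1=(V_1,E_1)$ be a finite regular graph of degree $d_1$ and let $\mathcal{G}_2=(V_2,E_2)$ be a finite regular graph of degree $d_2$. Let $A_1$ (resp. $A_2$) be the normalized adjacency matrix of $\mathcal{G}_1$ (resp. $\mathcal{G}_2$). Then the matrix wreath product $$\left(\frac{d_1}{d_1+d_2}A_1\right)\wr\left(\frac{d_2}{d_1+d_2}A_2\right)$$ is the transition matrix of the "Walk or switch" Lamplighter random walk on the graph $\mathcal{G}_1$ with color graph $\mathcal{G}_2$ (with respect to a suitable ordering of the states).
   Context: Wreath product of matrices: for $A\in\mathcal{M}_n(\mathbb{C})$ and $B\in\mathcal{M}_m(\mathbb{C})$, $$A\wr B = I_m^{\otimes n}\otimes A+\sum_{i=1}^n I_m^{\otimes (i-1)}\otimes B\otimes I_m^{\otimes (n-i)}\otimes C_i,$$ a square matrix of order $nm^n$. Here $\otimes$ is the Kronecker product, $I_m^{\otimes r}$ is the $r$-fold Kronecker power, with $I_m^{\otimes 0}=1$, and $C_i\in\mathcal{M}_n(\mathbb{C})$ has entry $1$ in position $(i,i)$ and $0$ elsewhere. Graphs are finite and undirected. The normalized adjacency matrix of a $d$-regular graph (with $d\geq 1$) is the square matrix, indexed by the vertices in some fixed ordering, whose $(i,j)$ entry is the number of edges connecting the $i$-th and $j$-th vertex, divided by $d$. The "Walk or switch" Lamplighter random walk on $\mathcal{G}_1$ with color graph $\mathcal{G}_2$ is the Markov chain with state space $\{(f,v): f:V_1\to V_2,\ v\in V_1\}$; the state $(f,v)$ means that the lamplighter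 is at the vertex $v$ and that for each $u\in V_1$ the lamp at $u$ has color $f(u)$. At each step, from $(f,v)$, one of the following $d_1+d_2$ moves is chosen uniformly at random: either move along one of the $d_1$ edges at $v$ in $\mathcal{G}_1$ to a neighbor $v'$ of $v$, leaving $f$ unchanged; or stay at $v$ and change the color of the lamp at $v$ along one of the $d_2$ edges at $f(v)$ in $\mathcal{G}_2$, leaving all other lamps unchanged. Equivalently, it is the simple random walk on the graph wreath product $\mathcal{G}_1\wr\mathcal{G}_2$. *)

theory Defs
  imports "HOL-Probability.Probability" "Jordan_Normal_Form.Matrix"
begin

definition kron :: "'a::semiring_1 mat \<Rightarrow> 'a mat \<Rightarrow> 'a mat" (infixl \<open>\<otimes>\<^sub>m\<close> 70) where
  "A \<otimes>\<^sub>m B = mat (dim_row A * dim_row B) (dim_col A * dim_col B)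
     (\<lambda>(i, j). A $$ (i div dim_row B, j div dim_col B) * B $$ (i mod dim_row B, j mod dim_col B))"

primrec kron_pow :: "'a::semiring_1 mat \<Rightarrow> nat \<Rightarrow> 'a mat" where
  "kron_pow A 0 = 1\<^sub>m 1"
| "kron_pow A (Suc r) = A \<otimes>\<^sub>m kron_pow A r"

definition mat_sum :: "nat \<Rightarrow> (nat \<Rightarrow> 'a::semiring_1 mat) \<Rightarrow> nat set \<Rightarrow> 'a mat" where
  "mat_sum N F I = mat N N (\<lambda>p. \<Sum>i\<in>I. F i $$ p)"

definition diag_unit :: "nat \<Rightarrow> nat \<Rightarrow> 'a::semiring_1 mat" where
  "diag_unit n k = mat n n (\<lambda>(i, j). if i = k \<and> j = k then 1 else 0)"

(* Matrix wreath product of A (order n) and B (order m); intended for square A and B only.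
   Indices start at 0, so the summand of index i has i factors I_m to the left of B. *)

definition mat_wreath :: "complex mat \<Rightarrow> complex mat \<Rightarrow> complex mat" (infixl \<open>\<wr>\<^sub>m\<close> 70) where
  "A \<wr>\<^sub>m B = (let n = dim_row A; m = dim_row B in
     kron_pow (1\<^sub>m m) n \<otimes>\<^sub>m A +
     mat_sum (n * m ^ n)
       (\<lambda>i. kron_pow (1\<^sub>m m) i \<otimes>\<^sub>m B \<otimes>\<^sub>m kron_pow (1\<^sub>m m) (n - 1 - i) \<otimes>\<^sub>m diag_unit n i) {..<n})"

(* Undirected graphs. Edges are named, so parallel edges are possible; an edge with a single
   endpoint is a loop. The degree is the number of edges at a vertex, so a loop counts once;
   this is what makes the rows of the normalized adjacency matrix sum to 1. *)

record ('v, 'e) ugraph =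
  verts :: "'v set"
  edges :: "'e set"
  ends :: "'e \<Rightarrow> 'v set"

definition finite_ugraph :: "('v, 'e) ugraph \<Rightarrow> bool" where
  "finite_ugraph G \<longleftrightarrow> finite (verts G) \<and> finite (edges G) \<and>
     (\<forall>e \<in> edges G. ends G e \<subseteq> verts G \<and> card (ends G e) \<in> {1, 2})"

definition edges_at :: "('v, 'e) ugraph \<Rightarrow> 'v \<Rightarrow> 'e set" where
  "edges_at G v = {e \<in> edges G. v \<in> ends G e}"

definition edges_between :: "('v, 'e) ugraph \<Rightarrow> 'v \<Rightarrow> 'v \<Rightarrow> 'e set" where
  "edges_between G u v = {e \<in> edges G. ends G e = {u, v}}"

definition regular_ugraph :: "('v, 'e) ugraph \<Rightarrow> nat \<Rightarrow> bool" where
  "regular_ugraph G d \<longleftrightarrow> (\<forall>v \<in> verts G. card (edges_at G v) = d)"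

(* For a loop e at v this is v itself. *)

definition other_end :: "('v, 'e) ugraph \<Rightarrow> 'e \<Rightarrow> 'v \<Rightarrow> 'v" where
  "other_end G e v = (THE w. ends G e = {v, w})"

definition is_ordering :: "'s list \<Rightarrow> 's set \<Rightarrow> bool" where
  "is_ordering xs S \<longleftrightarrow> distinct xs \<and> set xs = S"

definition normalized_adjacency :: "('v, 'e) ugraph \<Rightarrow> nat \<Rightarrow> 'v list \<Rightarrow> complex mat" where
  "normalized_adjacency G d vs = mat (length vs) (length vs)
     (\<lambda>(i, j). of_nat (card (edges_between G (vs ! i) (vs ! j))) / of_nat d)"

(* P is the transition matrix of the Markov chain on S with one-step distributions K,
   the states being listed in the order ss. *)

definition is_transition_matrix ::
    "complex mat \<Rightarrow> 's set \<Rightarrow> ('s \<Rightarrow> 's pmf) \<Rightarrow> 's list \<Rightarrow> bool" where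
  "is_transition_matrix P S K ss \<longleftrightarrow>
     is_ordering ss S \<and> (\<forall>s \<in> S. set_pmf (K s) \<subseteq> S) \<and>
     P = mat (length ss) (length ss) (\<lambda>(i, j). complex_of_real (pmf (K (ss ! i)) (ss ! j)))"

(* Lamp configurations are extensional functions, so that the state space is finite. *)

definition lamplighter_states ::
    "('v, 'e) ugraph \<Rightarrow> ('w, 'f) ugraph \<Rightarrow> (('v \<Rightarrow> 'w) \<times> 'v) set" where
  "lamplighter_states G H = (verts G \<rightarrow>\<^sub>E verts H) \<times> verts G"

(* Inl e: walk along the edge e of G.  Inr e: switch the current lamp along the edge e of H. *)

fun lamplighter_moves ::
    "('v, 'e) ugraph \<Rightarrow> ('w, 'f) ugraph \<Rightarrow> ('v \<Rightarrow> 'w) \<times> 'v \<Rightarrow> ('e + 'f) set" where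
  "lamplighter_moves G H (f, v) = edges_at G v <+> edges_at H (f v)"

fun lamplighter_apply ::
    "('v, 'e) ugraph \<Rightarrow> ('w, 'f) ugraph \<Rightarrow> ('v \<Rightarrow> 'w) \<times> 'v \<Rightarrow> 'e + 'f \<Rightarrow> ('v \<Rightarrow> 'w) \<times> 'v" where
  "lamplighter_apply G H (f, v) (Inl e) = (f, other_end G e v)"
| "lamplighter_apply G H (f, v) (Inr e) = (f(v := other_end H e (f v)), v)"

definition walk_or_switch ::
    "('v, 'e) ugraph \<Rightarrow> ('w, 'f) ugraph \<Rightarrow> ('v \<Rightarrow> 'w) \<times> 'v \<Rightarrow> (('v \<Rightarrow> 'w) \<times> 'v) pmf" where
  "walk_or_switch G H s = map_pmf (lamplighter_apply G H s) (pmf_of_set (lamplighter_moves G H s))"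

end

theory Submission
  imports Defs
begin

text \<open>A row index of the wreath product is \<open>p = c * n + k\<close> with \<open>c < m ^ n\<close> and \<open>k < n\<close>. Reading
  \<open>k\<close> as the position of the lamplighter and the base-\<open>m\<close> digits of \<open>c\<close>, most significant first, as
  the lamp colors enumerates the states. The block of the first summand is
  \<open>A\<close> for equal configurations, while the factors \<open>C\<^sub>i\<close> select from the sum the single term
  in which \<open>B\<close> acts on the digit of the current lamp and all other digits are fixed.
  Both contributions count the moves leading from one state to the other.\<close>

section \<open>Base-m digits\<close>

definition digit :: "nat \<Rightarrow> nat \<Rightarrow> nat \<Rightarrow> nat" where
  "digit m e c = c div m ^ e mod m"

lemma digit_less: "0 < m \<Longrightarrow> digit m e c < m"
  by (simp add: digit_def)

text \<open>On division by \<open>m ^ r\<close>, the number \<open>c mod m ^ Suc r\<close> has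
  quotient \<open>digit m r c\<close> and remainder \<open>c mod m ^ r\<close>, so each induction
  step adds exactly one digit.\<close>

lemma digits_eq_iff_mod_eq:
  assumes "0 < m"
  shows "(\<forall>j<r. digit m j c = digit m j c') \<longleftrightarrow> c mod m ^ r = c' mod m ^ r"
proof (induction r)
  case 0
  show ?case by simp
next
  case (Suc r)
  have split: "x mod m ^ Suc r = m ^ r * digit m r x + x mod m ^ r" for x
    using mod_mult2_eq[of x "m ^ r" m] by (simp add: digit_def mult.commute)
  have "x mod m ^ Suc r mod m ^ r = x mod m ^ r" for x
    unfolding split by simp
  moreover have "x mod m ^ Suc r div m ^ r = digit m r x" for x
    unfolding split using assms by simp
  ultimately have "c mod m ^ Suc r = c' mod m ^ Suc r \<longleftrightarrow>
      digit m r c = digit m r c' \<and> c mod m ^ r = c' mod m ^ r"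
    by (metis split)
  with Suc show ?case by (auto simp: less_Suc_eq)
qed

lemma digits_eq_iff_eq:
  assumes "c < m ^ r" "c' < m ^ r"
  shows "(\<forall>j<r. digit m j c = digit m j c') \<longleftrightarrow> c = c'"
proof (cases "m = 0")
  \<comment> \<open>For \<open>m = 0\<close> the bounds force \<open>r = 0\<close> and hence
    \<open>c = c' = 0\<close>.\<close>
  case True
  with assms show ?thesis by (cases r) auto
next
  case False
  with assms digits_eq_iff_mod_eq[of m r c c'] show ?thesis by simp
qed

text \<open>The quotient-remainder form on the right is what peeling identity factors off a
  Kronecker product on both sides of \<open>B\<close> produces: the remainder holds the digits below
  \<open>e\<close>, the iterated quotient those above.\<close>

lemma digits_eq_except_iff:
  assumes "0 < m" "e < n" "c < m ^ n" "c' < m ^ n"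
  shows "(\<forall>j<n. j \<noteq> e \<longrightarrow> digit m j c = digit m j c') \<longleftrightarrow>
    c mod m ^ e = c' mod m ^ e \<and> c div m ^ e div m = c' div m ^ e div m"
proof -
  let ?r = "n - Suc e"
  have n: "n = Suc e + ?r" using assms by simp
  have less: "x div m ^ e div m < m ^ ?r" if "x < m ^ n" for x
  proof -
    have "x < m ^ Suc e * m ^ ?r" using that n by (metis power_add)
    then have "x div m ^ Suc e < m ^ ?r" by (simp add: less_mult_imp_div_less mult.commute)
    then show ?thesis by (metis div_mult2_eq power_Suc2)
  qed
  have shift: "digit m j (x div m ^ e div m) = digit m (Suc e + j) x" for j x
    by (simp add: digit_def div_mult2_eq[symmetric] power_add ac_simps)
  \<comment> \<open>Removing \<open>e\<close> from the \<open>n\<close> positions leaves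
    \<open>e\<close> positions below it and \<open>n - Suc e\<close> above it.\<close>
  have "(\<forall>j<n. j \<noteq> e \<longrightarrow> P j) \<longleftrightarrow> (\<forall>j<e. P j) \<and> (\<forall>j<?r. P (Suc e + j))" for P
  proof (intro iffI conjI allI impI; (elim conjE)?)
    fix j assume *: "\<forall>j<e. P j" "\<forall>j<?r. P (Suc e + j)" "j < n" "j \<noteq> e"
    show "P j"
    proof (cases "j < e")
      case False
      then have "j - Suc e < ?r" "Suc e + (j - Suc e) = j" using * by auto
      with *(2) show ?thesis by metis
    qed (use * in auto)
  qed (use assms in auto)
  then show ?thesis
    using digits_eq_iff_mod_eq[OF assms(1), of e c c']
      digits_eq_iff_eq[OF less[OF assms(3)] less[OF assms(4)]]
    by (simp add: shift)
qed

section \<open>Entries of the matrix wreath product\<close>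

lemma dim_kron [simp]:
  "dim_row (A \<otimes>\<^sub>m B) = dim_row A * dim_row B"
  "dim_col (A \<otimes>\<^sub>m B) = dim_col A * dim_col B"
  by (simp_all add: kron_def)

lemma index_kron:
  assumes "i < dim_row A * dim_row B" "j < dim_col A * dim_col B"
  shows "(A \<otimes>\<^sub>m B) $$ (i, j) =
    A $$ (i div dim_row B, j div dim_col B) * B $$ (i mod dim_row B, j mod dim_col B)"
  using assms by (simp add: kron_def)

lemma div_mod_less_mult:
  fixes i a b :: nat
  assumes "i < a * b"
  shows "i div b < a" "i mod b < b"
  using assms by (simp_all add: less_mult_imp_div_less) (cases b; simp)

lemma kron_one: "1\<^sub>m a \<otimes>\<^sub>m 1\<^sub>m b = (1\<^sub>m (a * b) :: 'a::semiring_1 mat)"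
proof (rule eq_matI)
  fix i j
  assume "i < dim_row (1\<^sub>m (a * b) :: 'a mat)" "j < dim_col (1\<^sub>m (a * b) :: 'a mat)"
  then have ij: "i < a * b" "j < a * b" by auto
  have "i = j \<longleftrightarrow> i div b = j div b \<and> i mod b = j mod b"
    by (metis div_mult_mod_eq)
  with ij div_mod_less_mult[OF ij(1)] div_mod_less_mult[OF ij(2)]
  show "(1\<^sub>m a \<otimes>\<^sub>m 1\<^sub>m b) $$ (i, j) = (1\<^sub>m (a * b) :: 'a mat) $$ (i, j)"
    by (auto simp: index_kron)
qed simp_all

lemma kron_pow_one: "kron_pow (1\<^sub>m m) r = 1\<^sub>m (m ^ r)"
  by (induction r) (simp_all add: kron_one)

lemma index_kron_one_left:
  assumes "A \<in> carrier_mat n n" "p < a * n" "q < a * n"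
  shows "(1\<^sub>m a \<otimes>\<^sub>m A) $$ (p, q) =
    (if p div n = q div n then A $$ (p mod n, q mod n) else 0)"
  using assms div_mod_less_mult[OF assms(2)] div_mod_less_mult[OF assms(3)]
  by (auto simp: index_kron)

lemma index_kron_one_right:
  assumes "A \<in> carrier_mat n n" "p < n * a" "q < n * a"
  shows "(A \<otimes>\<^sub>m 1\<^sub>m a) $$ (p, q) =
    (if p mod a = q mod a then A $$ (p div a, q div a) else 0)"
  using assms div_mod_less_mult[OF assms(2)] div_mod_less_mult[OF assms(3)]
  by (auto simp: index_kron)

lemma index_kron_diag_unit:
  assumes "A \<in> carrier_mat a a" "p < a * n" "q < a * n"
  shows "(A \<otimes>\<^sub>m diag_unit n i) $$ (p, q) =
    (if p mod n = i \<and> q mod n = i then A $$ (p div n, q div n) else 0)"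
  using assms div_mod_less_mult[OF assms(2)] div_mod_less_mult[OF assms(3)]
  by (auto simp: index_kron diag_unit_def)

lemma dim_mat_wreath:
  assumes "A \<in> carrier_mat n n" "B \<in> carrier_mat m m"
  shows "A \<wr>\<^sub>m B \<in> carrier_mat (n * m ^ n) (n * m ^ n)"
  using assms by (auto simp: mat_wreath_def mat_sum_def Let_def)

text \<open>In the summand of index \<open>i\<close>, the factor \<open>B\<close> has
  \<open>n - 1 - i\<close> identities to its right and so acts on the digit of weight
  \<open>m ^ (n - 1 - i)\<close>. This is the source of the reversed position
  \<open>n - 1 - p mod n\<close>.\<close>

lemma index_mat_wreath:
  assumes A: "A \<in> carrier_mat n n" and B: "B \<in> carrier_mat m m"
    and p: "p < n * m ^ n" and q: "q < n * m ^ n"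
  shows "(A \<wr>\<^sub>m B) $$ (p, q) =
    (if p div n = q div n then A $$ (p mod n, q mod n) else 0) +
    (if p mod n = q mod n \<and>
        (\<forall>j<n. j \<noteq> n - 1 - p mod n \<longrightarrow> digit m j (p div n) = digit m j (q div n))
     then B $$ (digit m (n - 1 - p mod n) (p div n), digit m (n - 1 - p mod n) (q div n)) else 0)"
    (is "_ = ?walk + ?switch")
proof -
  define T where "T i = kron_pow (1\<^sub>m m) i \<otimes>\<^sub>m B \<otimes>\<^sub>m kron_pow (1\<^sub>m m) (n - 1 - i)" for i
  let ?k = "p mod n"
  let ?e = "n - 1 - ?k"
  have n: "n > 0" using p by (cases n) auto
  \<comment> \<open>For \<open>m = 0\<close> the order \<open>n * m ^ n\<close> would be
    \<open>0\<close>, leaving no room for \<open>p\<close>.\<close>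
  have m: "m > 0" using p n by (cases m) (auto simp: power_0_left)
  have pq: "p < m ^ n * n" "q < m ^ n * n" using p q by (simp_all add: mult.commute)
  note c = div_mod_less_mult[OF pq(1)] and c' = div_mod_less_mult[OF pq(2)]
  have pow: "m ^ i * m * m ^ (n - 1 - i) = m ^ n" if "i < n" for i
  proof -
    have "n = i + 1 + (n - 1 - i)" using that by simp
    then show ?thesis by (metis power_add power_one_right)
  qed
  have high: "p div n div m ^ ?e < m ^ ?k * m" "q div n div m ^ ?e < m ^ ?k * m"
    using c(1) c'(1) pow[OF c(2)] by (simp_all add: less_mult_imp_div_less)
  have T: "T i \<in> carrier_mat (m ^ n) (m ^ n)" if "i < n" for i
    using B pow[OF that] by (auto simp: T_def kron_pow_one)
  have "(\<Sum>i<n. (T i \<otimes>\<^sub>m diag_unit n i) $$ (p, q)) =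
      (\<Sum>i<n. if i = ?k then if q mod n = ?k then T ?k $$ (p div n, q div n) else 0 else 0)"
    by (intro sum.cong refl) (auto simp: index_kron_diag_unit[OF T pq])
  also have "\<dots> = (if q mod n = ?k then T ?k $$ (p div n, q div n) else 0)"
    using c(2) by simp
  \<comment> \<open>The product \<open>T ?k\<close> associates to the left, so its rightmost
    identity comes off first; it fixes the \<open>?e\<close> lowest digits.\<close>
  also have "T ?k $$ (p div n, q div n) =
      (if p div n mod m ^ ?e = q div n mod m ^ ?e
       then (1\<^sub>m (m ^ ?k) \<otimes>\<^sub>m B) $$ (p div n div m ^ ?e, q div n div m ^ ?e) else 0)"
    unfolding T_def kron_pow_one using B c(1) c'(1) pow[OF c(2)]
    by (intro index_kron_one_right) auto
  \<comment> \<open>The left identity fixes the digits above \<open>?e\<close>; the remainder modulo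
    \<open>m\<close> is the digit that \<open>B\<close> changes.\<close>
  also have "(1\<^sub>m (m ^ ?k) \<otimes>\<^sub>m B) $$ (p div n div m ^ ?e, q div n div m ^ ?e) =
      (if p div n div m ^ ?e div m = q div n div m ^ ?e div m
       then B $$ (digit m ?e (p div n), digit m ?e (q div n)) else 0)"
    unfolding digit_def by (rule index_kron_one_left[OF B high])
  finally have "(\<Sum>i<n. (T i \<otimes>\<^sub>m diag_unit n i) $$ (p, q)) = ?switch"
    using digits_eq_except_iff[OF m _ c(1) c'(1), of ?e] n by auto
  moreover have "(1\<^sub>m (m ^ n) \<otimes>\<^sub>m A) $$ (p, q) = ?walk"
    by (rule index_kron_one_left[OF A pq])
  moreover have "(A \<wr>\<^sub>m B) $$ (p, q) =
      (1\<^sub>m (m ^ n) \<otimes>\<^sub>m A) $$ (p, q) + (\<Sum>i<n. (T i \<otimes>\<^sub>m diag_unit n i) $$ (p, q))"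
    using A B p q by (simp add: mat_wreath_def mat_sum_def Let_def kron_pow_one T_def)
  ultimately show ?thesis by simp
qed

section \<open>Transition probabilities of the lamplighter walk\<close>

lemma other_end_eq:
  assumes "ends G e = {v, w}"
  shows "other_end G e v = w"
  unfolding other_end_def using assms by (intro the_equality) (auto simp: doubleton_eq_iff)

text \<open>A loop has a single endpoint, and \<open>v\<close> itself then serves as the other end;
  otherwise the two endpoints are distinct and one of them is \<open>v\<close>.\<close>

lemma ends_other_end:
  assumes "finite_ugraph G" "e \<in> edges_at G v"
  shows "ends G e = {v, other_end G e v}"
proof -
  have e: "v \<in> ends G e" "card (ends G e) \<in> {1, 2}"
    using assms by (auto simp: finite_ugraph_def edges_at_def)
  have "\<exists>w. ends G e = {v, w}"
  proof (cases "card (ends G e) = 1")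
    case True
    then obtain x where "ends G e = {x}" by (auto simp: card_1_singleton_iff)
    with e show ?thesis by auto
  next
    case False
    with e have "card (ends G e) = 2" by simp
    then obtain x y where "ends G e = {x, y}" by (auto simp: card_2_iff)
    with e show ?thesis by (auto simp: doubleton_eq_iff)
  qed
  then show ?thesis using other_end_eq by metis
qed

text \<open>Links the moves of the walk, given by incident edges, to the edge counts in the
  adjacency matrix; loops are the case \<open>w = v\<close>.\<close>

lemma edges_to_eq_edges_between:
  assumes "finite_ugraph G"
  shows "{e \<in> edges_at G v. other_end G e v = w} = edges_between G v w"
proof (intro equalityI subsetI)
  fix e assume "e \<in> {e \<in> edges_at G v. other_end G e v = w}"
  then show "e \<in> edges_between G v w"
    using ends_other_end[OF assms, of e v] by (auto simp: edges_at_def edges_between_def)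
next
  fix e assume "e \<in> edges_between G v w"
  then show "e \<in> {e \<in> edges_at G v. other_end G e v = w}"
    using other_end_eq[of G e v w] by (auto simp: edges_at_def edges_between_def)
qed

lemma other_end_in_verts:
  assumes "finite_ugraph G" "e \<in> edges_at G v"
  shows "other_end G e v \<in> verts G"
  using ends_other_end[OF assms] assms by (auto simp: finite_ugraph_def edges_at_def)

lemma finite_edges_at: "finite_ugraph G \<Longrightarrow> finite (edges_at G v)"
  by (simp add: finite_ugraph_def edges_at_def)

context
  fixes G :: "('v, 'e) ugraph" and H :: "('w, 'f) ugraph" and d\<^sub>1 d\<^sub>2 :: nat
  assumes G: "finite_ugraph G" "regular_ugraph G d\<^sub>1" "d\<^sub>1 \<ge> 1"
    and H: "finite_ugraph H" "regular_ugraph H d\<^sub>2"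
begin

lemma finite_lamplighter_moves: "finite (lamplighter_moves G H s)"
  by (cases s) (simp add: G H finite_edges_at)

lemma card_lamplighter_moves:
  assumes "s \<in> lamplighter_states G H"
  shows "card (lamplighter_moves G H s) = d\<^sub>1 + d\<^sub>2"
  using assms G H
  by (cases s) (auto simp: lamplighter_states_def card_Plus finite_edges_at regular_ugraph_def)

text \<open>Together with finiteness this makes \<open>pmf_of_set\<close> the uniform distribution
  on the moves.\<close>

lemma lamplighter_moves_nonempty:
  "s \<in> lamplighter_states G H \<Longrightarrow> lamplighter_moves G H s \<noteq> {}"
  using card_lamplighter_moves[of s] G(3) by auto

lemma set_pmf_walk_or_switch_subset:
  assumes "s \<in> lamplighter_states G H"
  shows "set_pmf (walk_or_switch G H s) \<subseteq> lamplighter_states G H"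
proof -
  have "lamplighter_apply G H s x \<in> lamplighter_states G H" if "x \<in> lamplighter_moves G H s" for x
    using assms that
    by (cases s; cases x)
      (auto simp: lamplighter_states_def PiE_iff extensional_def
        intro: other_end_in_verts[OF G(1)] other_end_in_verts[OF H(1)])
  then show ?thesis
    using lamplighter_moves_nonempty[OF assms] finite_lamplighter_moves
    by (auto simp: walk_or_switch_def)
qed

text \<open>The probability is the number of moves leading to \<open>(g, w)\<close> over the number
  of all moves. Both summands contribute when \<open>f = g\<close> and \<open>v = w\<close>: they
  count the loops at \<open>v\<close> and the loops at its color, kept apart by the disjoint
  sum.\<close>

lemma pmf_walk_or_switch:
  assumes "(f, v) \<in> lamplighter_states G H"
  shows "pmf (walk_or_switch G H (f, v)) (g, w) =
    ((if f = g then real (card (edges_between G v w)) else 0) +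
     (if v = w \<and> (\<forall>u. u \<noteq> v \<longrightarrow> f u = g u)
      then real (card (edges_between H (f v) (g v))) else 0)) / real (d\<^sub>1 + d\<^sub>2)"
proof -
  let ?M = "lamplighter_moves G H (f, v)"
  let ?E = "if f = g then edges_between G v w else {}"
  let ?F = "if v = w \<and> (\<forall>u. u \<noteq> v \<longrightarrow> f u = g u) then edges_between H (f v) (g v) else {}"
  have upd: "h(x := a) = g \<longleftrightarrow> a = g x \<and> (\<forall>u. u \<noteq> x \<longrightarrow> h u = g u)" for h x a
    by (auto simp: fun_eq_iff)
  have "?M \<inter> lamplighter_apply G H (f, v) -` {(g, w)} = ?E <+> ?F"
    unfolding edges_to_eq_edges_between[OF G(1), symmetric]
      edges_to_eq_edges_between[OF H(1), symmetric]
    by (auto simp: upd)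
  moreover have "finite ?E" "finite ?F"
    using G(1) H(1) by (auto simp: finite_ugraph_def edges_between_def)
  ultimately have "card (?M \<inter> lamplighter_apply G H (f, v) -` {(g, w)}) = card ?E + card ?F"
    by (simp only: card_Plus)
  moreover have "pmf (walk_or_switch G H (f, v)) (g, w) =
      real (card (?M \<inter> lamplighter_apply G H (f, v) -` {(g, w)})) / real (card ?M)"
    unfolding walk_or_switch_def pmf_map
    by (rule measure_pmf_of_set[OF lamplighter_moves_nonempty[OF assms] finite_lamplighter_moves])
  ultimately show ?thesis
    by (auto simp: card_lamplighter_moves[OF assms] simp del: lamplighter_moves.simps)
qed

end

section \<open>Enumeration of the states\<close>

text \<open>\<open>inv_into\<close> recovers the position of \<open>v\<close> in \<open>vs\<close>.
  Subtracting it from \<open>length vs - 1\<close> gives the first vertex the most significant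
  digit, matching the leftmost Kronecker factor. The restriction to \<open>set vs\<close> makes the
  configuration extensional.\<close>

definition lamp_config :: "'v list \<Rightarrow> 'w list \<Rightarrow> nat \<Rightarrow> 'v \<Rightarrow> 'w" where
  "lamp_config vs ws c = (\<lambda>v\<in>set vs.
     ws ! digit (length ws) (length vs - 1 - inv_into {..<length vs} ((!) vs) v) c)"

definition nth_state :: "'v list \<Rightarrow> 'w list \<Rightarrow> nat \<Rightarrow> ('v \<Rightarrow> 'w) \<times> 'v" where
  "nth_state vs ws p = (lamp_config vs ws (p div length vs), vs ! (p mod length vs))"

lemma lamp_config_nth:
  assumes "distinct vs" "i < length vs"
  shows "lamp_config vs ws c (vs ! i) = ws ! digit (length ws) (length vs - 1 - i) c"
  using assms by (simp add: lamp_config_def inj_on_nth inv_into_f_f)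

lemma lamp_config_PiE:
  assumes "distinct vs" "ws \<noteq> []"
  shows "lamp_config vs ws c \<in> set vs \<rightarrow>\<^sub>E set ws"
  using assms by (auto simp: lamp_config_def digit_less)

text \<open>Translates the condition for a switch in \<open>pmf_walk_or_switch\<close> into the one
  in \<open>index_mat_wreath\<close>. Reversal permutes the positions, distinct colors separate
  digits, and outside \<open>set vs\<close> both configurations are
  \<open>undefined\<close>.\<close>

lemma lamp_config_agree_iff:
  assumes vs: "distinct vs" and ws: "distinct ws" "ws \<noteq> []" and k: "k < length vs"
  shows "(\<forall>u. u \<noteq> vs ! k \<longrightarrow> lamp_config vs ws c u = lamp_config vs ws c' u) \<longleftrightarrow>
    (\<forall>j<length vs. j \<noteq> length vs - 1 - k \<longrightarrow> digit (length ws) j c = digit (length ws) j c')"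
    (is "?L \<longleftrightarrow> ?R")
proof -
  let ?n = "length vs" and ?m = "length ws"
  have nth: "lamp_config vs ws c (vs ! i) = lamp_config vs ws c' (vs ! i) \<longleftrightarrow>
      digit ?m (?n - 1 - i) c = digit ?m (?n - 1 - i) c'" if "i < ?n" for i
    using that vs ws by (simp add: lamp_config_nth nth_eq_iff_index_eq digit_less)
  show ?thesis
  proof
    assume L: ?L
    show ?R
    proof (intro allI impI)
      fix j assume j: "j < ?n" "j \<noteq> ?n - 1 - k"
      \<comment> \<open>Reversal is its own inverse, so the digit \<open>j\<close> belongs to the
        vertex at position \<open>?n - 1 - j\<close>.\<close>
      then have i: "?n - 1 - j < ?n" "?n - 1 - j \<noteq> k" "?n - 1 - (?n - 1 - j) = j" by auto
      then have "vs ! (?n - 1 - j) \<noteq> vs ! k" using vs k by (simp add: nth_eq_iff_index_eq)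
      with L nth[OF i(1)] i(3) show "digit ?m j c = digit ?m j c'" by simp
    qed
  next
    assume R: ?R
    show ?L
    proof (intro allI impI)
      fix u assume u: "u \<noteq> vs ! k"
      show "lamp_config vs ws c u = lamp_config vs ws c' u"
      proof (cases "u \<in> set vs")
        case True
        then obtain i where i: "i < ?n" "u = vs ! i" by (auto simp: in_set_conv_nth)
        then have "i \<noteq> k" using u by auto
        then have "?n - 1 - i < ?n" "?n - 1 - i \<noteq> ?n - 1 - k" using i(1) k by linarith+
        with R nth i show ?thesis by simp
      qed (simp add: lamp_config_def)
    qed
  qed
qed

lemma lamp_config_eq_iff:
  assumes vs: "distinct vs" "vs \<noteq> []" and ws: "distinct ws" "ws \<noteq> []"
    and c: "c < length ws ^ length vs" "c' < length ws ^ length vs"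
  shows "lamp_config vs ws c = lamp_config vs ws c' \<longleftrightarrow> c = c'"
proof
  assume eq: "lamp_config vs ws c = lamp_config vs ws c'"
  let ?n = "length vs" and ?m = "length ws"
  have "digit ?m j c = digit ?m j c'" if j: "j < ?n" for j
  proof -
    have i: "?n - 1 - j < ?n" "?n - 1 - (?n - 1 - j) = j" using j by auto
    have "ws ! digit ?m j c = ws ! digit ?m j c'"
      using lamp_config_nth[OF vs(1) i(1)] eq i(2) by metis
    then show ?thesis using ws by (simp add: nth_eq_iff_index_eq digit_less)
  qed
  then show "c = c'" using digits_eq_iff_eq[OF c] by simp
qed simp

text \<open>Surjectivity follows by counting: \<open>nth_state\<close> is injective on
  \<open>?N\<close> indices and maps into a set of exactly \<open>?N\<close> states.\<close>

lemma is_ordering_nth_state: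
  assumes "is_ordering vs (verts G)" "is_ordering ws (verts H)"
  shows "is_ordering (map (nth_state vs ws) [0..<length vs * length ws ^ length vs])
    (lamplighter_states G H)"
proof -
  let ?n = "length vs" and ?m = "length ws"
  let ?N = "?n * ?m ^ ?n"
  have vs: "distinct vs" "set vs = verts G" and ws: "distinct ws" "set ws = verts H"
    using assms by (auto simp: is_ordering_def)
  \<comment> \<open>Both vertex lists are nonempty as soon as some index lies below
    \<open>?N\<close>; if one of the graphs makes \<open>?N\<close> zero, there are no indices to
    treat.\<close>
  have dims: "vs \<noteq> []" "ws \<noteq> []" "p div ?n < ?m ^ ?n" "p mod ?n < ?n" if "p < ?N" for p
  proof -
    have p: "p < ?m ^ ?n * ?n" using that by (simp add: mult.commute)
    show "p div ?n < ?m ^ ?n" "p mod ?n < ?n" by (rule div_mod_less_mult[OF p])+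
    show "vs \<noteq> []" using that by auto
    then show "ws \<noteq> []" using that by (auto simp: power_0_left)
  qed
  have inj: "inj_on (nth_state vs ws) {..<?N}"
  proof (rule inj_onI)
    fix p q assume pq: "p \<in> {..<?N}" "q \<in> {..<?N}" "nth_state vs ws p = nth_state vs ws q"
    note dp = dims[of p] and dq = dims[of q]
    have "p div ?n = q div ?n"
      using pq dp dq lamp_config_eq_iff[OF vs(1) _ ws(1)] by (auto simp: nth_state_def)
    moreover have "p mod ?n = q mod ?n"
      using pq dp dq vs(1) by (auto simp: nth_state_def nth_eq_iff_index_eq)
    ultimately show "p = q" by (metis div_mult_mod_eq)
  qed
  have "nth_state vs ws ` {..<?N} \<subseteq> lamplighter_states G H"
    using dims lamp_config_PiE[OF vs(1), of ws] vs(2) ws(2) nth_mem[of _ vs]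
    by (fastforce simp: nth_state_def lamplighter_states_def simp del: PiE_iff)
  moreover have "card (lamplighter_states G H) = ?N" "finite (lamplighter_states G H)"
    using distinct_card[OF vs(1)] distinct_card[OF ws(1)]
    by (simp_all add: lamplighter_states_def card_cartesian_product card_PiE
        vs(2)[symmetric] ws(2)[symmetric] finite_PiE)
  ultimately have "nth_state vs ws ` {..<?N} = lamplighter_states G H"
    using card_image[OF inj] by (intro card_subset_eq) auto
  with inj show ?thesis
    by (simp add: is_ordering_def distinct_map atLeast0LessThan)
qed

theorem corollary3p3:
  fixes G1 :: "('v, 'e) ugraph" and G2 :: "('w, 'f) ugraph"
    and d1 d2 :: nat and vs1 :: "'v list" and vs2 :: "'w list"
    and A1 A2 :: "complex mat"
  assumes "finite_ugraph G1" and "regular_ugraph G1 d1" and "d1 \<ge> 1"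
    and "finite_ugraph G2" and "regular_ugraph G2 d2" and "d2 \<ge> 1"
    and "is_ordering vs1 (verts G1)" and "is_ordering vs2 (verts G2)"
    and "A1 = normalized_adjacency G1 d1 vs1"
    and "A2 = normalized_adjacency G2 d2 vs2"
  shows "\<exists>ss. is_transition_matrix
           ((of_nat d1 / of_nat (d1 + d2) \<cdot>\<^sub>m A1) \<wr>\<^sub>m (of_nat d2 / of_nat (d1 + d2) \<cdot>\<^sub>m A2))
           (lamplighter_states G1 G2) (walk_or_switch G1 G2) ss"
proof -
  let ?n = "length vs1" and ?m = "length vs2"
  let ?N = "?n * ?m ^ ?n"
  let ?A = "of_nat d1 / of_nat (d1 + d2) \<cdot>\<^sub>m A1" and ?B = "of_nat d2 / of_nat (d1 + d2) \<cdot>\<^sub>m A2"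
  let ?ss = "map (nth_state vs1 vs2) [0..<?N]"
  have A: "?A \<in> carrier_mat ?n ?n" and B: "?B \<in> carrier_mat ?m ?m"
    using assms(9,10) by (auto simp: normalized_adjacency_def)
  have ss: "is_ordering ?ss (lamplighter_states G1 G2)"
    by (rule is_ordering_nth_state[OF assms(7,8)])
  have vs: "distinct vs1" "distinct vs2" using assms(7,8) by (auto simp: is_ordering_def)
  note walk = assms(1-5)
  have "?A \<wr>\<^sub>m ?B = mat (length ?ss) (length ?ss)
      (\<lambda>(i, j). complex_of_real (pmf (walk_or_switch G1 G2 (?ss ! i)) (?ss ! j)))"
  proof (rule eq_matI)
    fix p q
    assume "p < dim_row (mat (length ?ss) (length ?ss)
        (\<lambda>(i, j). complex_of_real (pmf (walk_or_switch G1 G2 (?ss ! i)) (?ss ! j))))"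
      and "q < dim_col (mat (length ?ss) (length ?ss)
        (\<lambda>(i, j). complex_of_real (pmf (walk_or_switch G1 G2 (?ss ! i)) (?ss ! j))))"
    then have p: "p < ?N" and q: "q < ?N" by auto
    let ?c = "p div ?n" and ?c' = "q div ?n" and ?k = "p mod ?n" and ?l = "q mod ?n"
    let ?f = "lamp_config vs1 vs2 ?c" and ?g = "lamp_config vs1 vs2 ?c'"
    let ?e = "?n - 1 - ?k"
    have pq: "p < ?m ^ ?n * ?n" "q < ?m ^ ?n * ?n" using p q by (simp_all add: mult.commute)
    note c = div_mod_less_mult[OF pq(1)] and c' = div_mod_less_mult[OF pq(2)]
    have ne: "vs1 \<noteq> []" using p by auto
    then have ne2: "vs2 \<noteq> []" using p by (auto simp: power_0_left)
    have digits: "digit ?m ?e ?c < ?m" "digit ?m ?e ?c' < ?m" using ne2 by (simp_all add: digit_less)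
    have "nth_state vs1 vs2 p \<in> set ?ss" using p by auto
    then have state: "(?f, vs1 ! ?k) \<in> lamplighter_states G1 G2"
      using ss by (simp add: is_ordering_def nth_state_def)
    \<comment> \<open>The factor \<open>d1\<close> cancels the normalization, leaving an edge count
      over the total number \<open>d1 + d2\<close> of moves.\<close>
    have entry_A: "?A $$ (?k, ?l) =
        of_nat (card (edges_between G1 (vs1 ! ?k) (vs1 ! ?l))) / of_nat (d1 + d2)"
      using c c' assms(3,9) by (simp add: normalized_adjacency_def)
    \<comment> \<open>Both colors are read at the vertex of position \<open>?k\<close>; in a switch
      the lamplighter stays there.\<close>
    have entry_B: "?B $$ (digit ?m ?e ?c, digit ?m ?e ?c') =
        of_nat (card (edges_between G2 (?f (vs1 ! ?k)) (?g (vs1 ! ?k)))) / of_nat (d1 + d2)"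
      using c digits assms(6,10) vs by (simp add: normalized_adjacency_def lamp_config_nth)
    have pos_eq: "vs1 ! ?k = vs1 ! ?l \<longleftrightarrow> ?k = ?l"
      using vs c c' by (simp add: nth_eq_iff_index_eq)
    \<comment> \<open>After the rewriting both sides carry the same conditions and edge counts; only
      the division by \<open>d1 + d2\<close> has to be distributed over the sum.\<close>
    have "(?A \<wr>\<^sub>m ?B) $$ (p, q) =
        complex_of_real (pmf (walk_or_switch G1 G2 (?f, vs1 ! ?k)) (?g, vs1 ! ?l))"
      unfolding index_mat_wreath[OF A B p q] pmf_walk_or_switch[OF walk state] entry_A entry_B
        lamp_config_agree_iff[OF vs ne2 c(2)] pos_eq
        lamp_config_eq_iff[OF vs(1) ne vs(2) ne2 c(1) c'(1)]
      by (auto simp: add_divide_distrib)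
    with p q show "(?A \<wr>\<^sub>m ?B) $$ (p, q) = mat (length ?ss) (length ?ss)
        (\<lambda>(i, j). complex_of_real (pmf (walk_or_switch G1 G2 (?ss ! i)) (?ss ! j))) $$ (p, q)"
      by (simp add: nth_state_def)
  qed (use dim_mat_wreath[OF A B] in auto)
  with ss set_pmf_walk_or_switch_subset[OF walk] show ?thesis
    unfolding is_transition_matrix_def by blast
qed

end
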